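(* Let $r>0$ and let $\mathcal D$ be any $r$-separated distribution over $\mathcal X\times\{\pm1\}$. Let $(k_n)$ be any sequence (of positive integers, $k_n\le n$) such that $\lim_{n\to\infty}\frac{k_n}{n}=0$, and let $M$ be the $k_n$-nearest neighbors classifier on a sample $S\sim\mathcal D^n$. Then $M$ is $r$-consistent with respect to $\mathcal D$.
   Context: $\mathcal X$ is a totally bounded metric space with metric $d$; $B(x,r)$ is the closed ball of radius $r$ centered at $x$; labels are in $\{\pm1\}=\{-1,+1\}$. Given a sample $S=\{(x_1,y_1),\dots,(x_n,y_n)\}$, the $k_n$-nearest neighbors classifier assigns weights $w_i^S(x)=\frac1{k_n}$ if $x_i$ is one of the $k_n$ closest points to $x$ among $x_1,\dots,x_n$ (ties broken by some rule not depending on the labels) and $w_i^S(x)=0$ otherwise; it predicts $+1$ at $x$ if $\sum_{i=1}^n w_i^S(x)y_i>0$ and $-1$ otherwise. The astuteness of a classifier $f:\mathcal X\to\{\pm1\}$ at radius $\rho\ge 0$ is $A_\rho(f,\mathcal D)=P_{(x,y)\sim\mathcal D}[f(x')=y\ \ \forall x'\in B(x,\rho)]$, and $A_r^*(\mathcal D)$ is the maximum of $A_r(f,\mathcal D)$ over all $f:\mathcal X\to\{\pm1\}$. A classification algorithm $M$ (mapping a sample $S$ to a classifier $M(S)$) is $r$-consistent with respect to $\mathcal D$ if for any $\epsilon,\delta\in(0,1)$ and $0<\gamma<r$ there exists $N$ such that for all $n\ge N$, with probability at least $1-\delta$ over $S\sim\mathcal D^n$, $A_{r-\gamma}(M(S),\mathcal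 D)\ge A_r^*(\mathcal D)-\epsilon$. $\mathcal D$ is $r$-separated if there exist subsets $T^+,T^-\subset\mathcal X$ such that $P_{(x,y)\sim\mathcal D}[x\in T^y]=1$ (where $T^{+1}=T^+$, $T^{-1}=T^-$) and $d(x_1,x_2)>2r$ for all $x_1\in T^+$, $x_2\in T^-$. *)

theory Defs
  imports "HOL-Probability.Probability"
begin

text \<open>
  Labels are the integers \<open>-1\<close> and \<open>1\<close>. A distribution over labelled points is a probability
  measure on the product of the Borel sigma-algebra and the discrete one, so that
  \<open>space D = UNIV \<times> {-1, 1}\<close>.
\<close>

definition labels :: "int set" where
  "labels = {-1, 1}"

definition labelled_distribution :: "('a::metric_space \<times> int) measure \<Rightarrow> bool" where
  "labelled_distribution D \<longleftrightarrow>
     prob_space D \<and> sets D = sets (borel \<Otimes>\<^sub>M count_space labels)"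

text \<open>
  The events below need not be measurable: they quantify over all points of a ball, classifiers
  are arbitrary functions, and so are tie-breaking rules. As \<open>measure\<close> is \<open>0\<close> off the
  sigma-algebra, their probability is taken to be the inner one, i.e. the supremum of the
  probabilities of the measurable events they contain. Hence a lower bound on it is witnessed,
  up to any positive error, by a measurable event.
\<close>

definition inner_prob :: "'b measure \<Rightarrow> 'b set \<Rightarrow> real" where
  "inner_prob M A = (SUP B\<in>{B \<in> sets M. B \<subseteq> A}. measure M B)"

lemma (in prob_space) inner_prob_eq_prob:
  assumes "A \<in> events"
  shows "inner_prob M A = prob A"
  unfolding inner_prob_def
proof (rule cSup_eq_maximum)
  show "prob A \<in> prob ` {B \<in> events. B \<subseteq> A}"
    using assms by auto
  show "p \<le> prob A" if "p \<in> prob ` {B \<in> events. B \<subseteq> A}" for p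
    using that assms by (auto intro: finite_measure_mono)
qed

definition astuteness :: "real \<Rightarrow> ('a::metric_space \<Rightarrow> int) \<Rightarrow> ('a \<times> int) measure \<Rightarrow> real" where
  "astuteness \<rho> f D = inner_prob D {(x, y) \<in> space D. \<forall>x'\<in>cball x \<rho>. f x' = y}"

definition optimal_astuteness :: "real \<Rightarrow> ('a::metric_space \<times> int) measure \<Rightarrow> real" where
  "optimal_astuteness r D = (SUP f\<in>{f. range f \<subseteq> labels}. astuteness r f D)"

definition r_separated :: "real \<Rightarrow> ('a::metric_space \<times> int) measure \<Rightarrow> bool" where
  "r_separated r D \<longleftrightarrow>
     (\<exists>Tpos Tneg. (AE (x, y) in D. x \<in> (if y = 1 then Tpos else Tneg)) \<and>
        (\<forall>x1\<in>Tpos. \<forall>x2\<in>Tneg. dist x1 x2 > 2 * r))"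

text \<open>
  A sample of size \<open>n\<close> is a function on the index set \<open>{..<n}\<close>; a classification algorithm
  takes the sample size and the sample.
\<close>

type_synonym 'a algorithm = "nat \<Rightarrow> (nat \<Rightarrow> 'a \<times> int) \<Rightarrow> 'a \<Rightarrow> int"

definition r_consistent ::
  "real \<Rightarrow> 'a::metric_space algorithm \<Rightarrow> ('a \<times> int) measure \<Rightarrow> bool" where
  "r_consistent r M D \<longleftrightarrow>
     (\<forall>\<epsilon> \<delta> \<gamma>. 0 < \<epsilon> \<and> \<epsilon> < 1 \<and> 0 < \<delta> \<and> \<delta> < 1 \<and> 0 < \<gamma> \<and> \<gamma> < r \<longrightarrow>
        (\<exists>N. \<forall>n\<ge>N.
           inner_prob (\<Pi>\<^sub>M i\<in>{..<n}. D)
             {S \<in> space (\<Pi>\<^sub>M i\<in>{..<n}. D).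
                astuteness (r - \<gamma>) (M n S) D \<ge> optimal_astuteness r D - \<epsilon>}
           \<ge> 1 - \<delta>))"

text \<open>
  A neighbour rule \<open>nb\<close> maps the sample size, the sample points and the query point to the
  indices of \<open>k n\<close> nearest sample points. It embodies the tie-breaking, which is otherwise
  arbitrary; since its arguments do not include the labels, neither does the tie-breaking depend
  on them.
\<close>

definition nearest_neighbour_rule ::
  "(nat \<Rightarrow> nat) \<Rightarrow> (nat \<Rightarrow> (nat \<Rightarrow> 'a::metric_space) \<Rightarrow> 'a \<Rightarrow> nat set) \<Rightarrow> bool" where
  "nearest_neighbour_rule k nb \<longleftrightarrow>
     (\<forall>n\<ge>1. \<forall>xs x.
        nb n xs x \<subseteq> {..<n} \<and> card (nb n xs x) = k n \<and>
        (\<forall>i\<in>nb n xs x. \<forall>j\<in>{..<n} - nb n xs x. dist x (xs i) \<le> dist x (xs j)))"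

definition knn_weight ::
  "(nat \<Rightarrow> nat) \<Rightarrow> (nat \<Rightarrow> (nat \<Rightarrow> 'a) \<Rightarrow> 'a \<Rightarrow> nat set) \<Rightarrow>
     nat \<Rightarrow> (nat \<Rightarrow> 'a \<times> int) \<Rightarrow> nat \<Rightarrow> 'a \<Rightarrow> real" where
  "knn_weight k nb n S i x = (if i \<in> nb n (\<lambda>j. fst (S j)) x then 1 / real (k n) else 0)"

definition knn_classifier ::
  "(nat \<Rightarrow> nat) \<Rightarrow> (nat \<Rightarrow> (nat \<Rightarrow> 'a) \<Rightarrow> 'a \<Rightarrow> nat set) \<Rightarrow> 'a algorithm" where
  "knn_classifier k nb n S x =
     (if (\<Sum>i<n. knn_weight k nb n S i x * real_of_int (snd (S i))) > 0 then 1 else -1)"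

end

theory Submission
  imports Defs
begin

text \<open>
  Cover the space by finitely many balls of diameter less than \<open>\<gamma>\<close> and discard those of
  probability zero. By Hoeffding's inequality and \<open>k\<^sub>n / n \<longrightarrow> 0\<close>, with high probability each
  remaining ball contains at least \<open>k\<^sub>n\<close> sample points. For \<open>x\<close> in such a ball and \<open>x'\<close> within
  \<open>r - \<gamma>\<close> of \<open>x\<close>, all \<open>k\<^sub>n\<close> nearest neighbours of \<open>x'\<close> are then within \<open>r\<close> of \<open>x'\<close>, hence within
  \<open>2 r\<close> of \<open>x\<close>, so separation gives them the label of \<open>x\<close>. Thus the classifier has astuteness 1.
\<close>

section \<open>Inner probability\<close>

text \<open>Intersecting \<open>B\<close> with a measurable set of probability 1 on which the
  implication holds keeps the probability of \<open>B\<close> and yields a measurable subset of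
  \<open>A\<close>. Thus \<open>A\<close> itself may be nonmeasurable.\<close>

lemma (in prob_space) prob_le_inner_prob_AE:
  assumes "B \<in> events" "AE x in M. x \<in> B \<longrightarrow> x \<in> A"
  shows "prob B \<le> inner_prob M A"
proof -
  obtain C where C: "C \<subseteq> {x \<in> space M. x \<in> B \<longrightarrow> x \<in> A}" "C \<in> events" "prob C = 1"
    using AE_E_prob[OF assms(2)] by metis
  have "AE x in M. x \<in> C"
    using C by (simp add: AE_in_set_eq_1)
  then have "prob B = prob (B \<inter> C)"
    using assms(1) C(2) by (intro finite_measure_eq_AE) auto
  also have "\<dots> \<le> inner_prob M A"
    unfolding inner_prob_def
    by (rule cSUP_upper) (use assms(1) C in \<open>auto intro!: bdd_aboveI[of _ 1]\<close>)
  finally show ?thesis .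
qed

lemma (in prob_space) inner_prob_le_1: "inner_prob M A \<le> 1"
  unfolding inner_prob_def by (rule cSUP_least) auto

lemma (in prob_space) inner_prob_eq_1:
  assumes "AE x in M. x \<in> A"
  shows "inner_prob M A = 1"
  using prob_le_inner_prob_AE[of "space M" A] inner_prob_le_1[of A] assms
  by (auto simp: prob_space)

text \<open>This bound on the optimum suffices, as the nearest neighbours classifier is shown to
  attain astuteness 1 with high probability.\<close>

lemma optimal_astuteness_le_1:
  assumes "prob_space D"
  shows "optimal_astuteness r D \<le> 1"
  unfolding optimal_astuteness_def
proof (rule cSUP_least)
  have "range (\<lambda>_::'a. 1) \<subseteq> labels" by (auto simp: labels_def)
  then show "{f :: 'a \<Rightarrow> int. range f \<subseteq> labels} \<noteq> {}" by blast
qed (simp add: astuteness_def prob_space.inner_prob_le_1[OF assms])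

section \<open>Concentration of hit counts in an i.i.d. sample\<close>

text \<open>The joint law of the coordinates is the law of the identity, hence the product of the
  marginals, which characterises independence for nonempty \<open>I\<close>.\<close>

lemma indep_vars_PiM_projections:
  assumes "\<And>i. i \<in> I \<Longrightarrow> prob_space (M i)"
  shows "prob_space.indep_vars (PiM I M) M (\<lambda>i \<omega>. \<omega> i) I"
proof -
  interpret prob_space "PiM I M" using assms by (rule prob_space_PiM)
  show ?thesis
  proof (cases "I = {}")
    case True
    then show ?thesis unfolding indep_vars_def indep_sets_def by blast
  next
    case False
    have "distr (PiM I M) (PiM I M) (\<lambda>\<omega>. \<lambda>i\<in>I. \<omega> i) = distr (PiM I M) (PiM I M) (\<lambda>\<omega>. \<omega>)"
      by (rule distr_cong) (auto simp: space_PiM)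
    also have "\<dots> = PiM I M" by simp
    also have "\<dots> = (\<Pi>\<^sub>M i\<in>I. distr (PiM I M) (M i) (\<lambda>\<omega>. \<omega> i))"
      by (rule PiM_cong) (auto simp: distr_PiM_component assms)
    finally show ?thesis
      using False by (subst indep_vars_iff_distr_eq_PiM') auto
  qed
qed

lemma prob_PiM_few_hits_le:
  fixes n :: nat
  assumes "prob_space D" "A \<in> sets D" "n > 0"
  shows "measure (\<Pi>\<^sub>M i\<in>{..<n}. D)
           {S \<in> space (\<Pi>\<^sub>M i\<in>{..<n}. D). real (card {i\<in>{..<n}. S i \<in> A}) \<le> real n * measure D A / 2}
         \<le> exp (- (measure D A)\<^sup>2 / 2 * real n)"
proof -
  let ?P = "\<Pi>\<^sub>M i\<in>{..<n}. D" and ?p = "measure D A"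
  interpret D: prob_space D by fact
  interpret P: prob_space ?P by (rule prob_space_PiM) (rule assms(1))
  have *: "P.expectation (\<lambda>S. indicat_real A (S i)) = ?p" if "i < n" for i
  proof -
    have "P.expectation (\<lambda>S. indicat_real A (S i))
        = integral\<^sup>L (distr ?P D (\<lambda>S. S i)) (indicat_real A)"
      using that assms by (subst integral_distr) auto
    also have "distr ?P D (\<lambda>S. S i) = D"
      using that assms by (subst distr_PiM_component) auto
    finally show ?thesis
      using assms(2) by simp
  qed
  interpret H: Hoeffding_ineq ?P "{..<n}" "\<lambda>i S. indicat_real A (S i)" "\<lambda>_. 0" "\<lambda>_. 1"
    "real n * ?p"
  proof unfold_locales
    show "P.indep_vars (\<lambda>_. borel) (\<lambda>i S. indicat_real A (S i)) {..<n}"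
      by (rule P.indep_vars_compose2[OF indep_vars_PiM_projections]) (use assms in auto)
  qed (simp_all add: *)
  have hits: "(\<Sum>i<n. indicat_real A (S i)) = real (card {i\<in>{..<n}. S i \<in> A})" for S
    by (simp add: indicator_def sum.If_cases Int_def)
  \<comment> \<open>Half the mean is written as the mean minus a deviation \<open>n * p / 2\<close>.
    The indicators have range width 1, so the exponent is
    \<open>-2 * (n * p / 2)^2 / n = - p^2 / 2 * n\<close>.\<close>
  have "P.prob {S \<in> space ?P. (\<Sum>i<n. indicat_real A (S i)) \<le> real n * ?p - real n * ?p / 2}
      \<le> exp (-2 * (real n * ?p / 2)\<^sup>2 / (\<Sum>i<n. (1 - 0)\<^sup>2))"
    by (rule H.Hoeffding_ineq_le) (use assms in auto)
  then show ?thesis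
    using assms(3) by (simp add: hits power2_eq_square mult.commute)
qed

text \<open>Once \<open>k n\<close> is below half of every expected count, too few hits in some
  \<open>A\<close> is a Hoeffding deviation; a union bound over the finite family leaves a vanishing
  sum of exponentials.\<close>

lemma prob_PiM_hits_tendsto_1:
  fixes k :: "nat \<Rightarrow> nat"
  assumes "prob_space D" "finite \<A>" "\<A> \<subseteq> sets D" "\<And>A. A \<in> \<A> \<Longrightarrow> measure D A > 0"
    and "(\<lambda>n. real (k n) / real n) \<longlonglongrightarrow> 0"
  shows "(\<lambda>n. measure (\<Pi>\<^sub>M i\<in>{..<n}. D)
            {S \<in> space (\<Pi>\<^sub>M i\<in>{..<n}. D). \<forall>A\<in>\<A>. k n \<le> card {i\<in>{..<n}. S i \<in> A}}) \<longlonglongrightarrow> 1"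
proof (rule tendsto_sandwich)
  let ?P = "\<lambda>n. \<Pi>\<^sub>M i\<in>{..<n}. D"
  have P: "prob_space (?P n)" for n :: nat by (rule prob_space_PiM) (rule assms(1))
  have "\<forall>\<^sub>F n in sequentially. \<forall>A\<in>\<A>. real (k n) \<le> real n * measure D A / 2 \<and> n > 0"
  proof (intro eventually_ball_finite ballI assms(2))
    fix A assume "A \<in> \<A>"
    then have "measure D A / 2 > 0" using assms by simp
    from order_tendstoD(2)[OF assms(5) this] eventually_gt_at_top[of 0]
    show "\<forall>\<^sub>F n in sequentially. real (k n) \<le> real n * measure D A / 2 \<and> n > 0"
      by eventually_elim (auto simp: field_simps)
  qed
  then show "\<forall>\<^sub>F n in sequentially. 1 - (\<Sum>A\<in>\<A>. exp (- (measure D A)\<^sup>2 / 2 * real n)) \<le>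
      measure (?P n) {S \<in> space (?P n). \<forall>A\<in>\<A>. k n \<le> card {i\<in>{..<n}. S i \<in> A}}"
  proof eventually_elim
    case (elim n)
    interpret prob_space "?P n" by (rule P)
    define few where
      "few A = {S \<in> space (?P n). real (card {i\<in>{..<n}. S i \<in> A}) \<le> real n * measure D A / 2}"
      for A
    define enough where
      "enough = {S \<in> space (?P n). \<forall>A\<in>\<A>. k n \<le> card {i\<in>{..<n}. S i \<in> A}}"
    have card_meas: "(\<lambda>S. real (card {i\<in>{..<n}. S i \<in> A})) \<in> borel_measurable (?P n)"
      if "A \<in> \<A>" for A
    proof -
      have [measurable]: "A \<in> sets D" using that assms by auto
      have "(\<lambda>S. real (card {i\<in>{..<n}. S i \<in> A})) = (\<lambda>S. \<Sum>i<n. indicat_real A (S i))"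
        by (simp add: indicator_def sum.If_cases Int_def)
      also have "\<dots> \<in> borel_measurable (?P n)" by measurable
      finally show ?thesis .
    qed
    have few: "few A \<in> events" if "A \<in> \<A>" for A
      unfolding few_def by (intro borel_measurable_le card_meas that borel_measurable_const)
    \<comment> \<open>Monotonicity of \<open>measure\<close> needs the larger set to be
      measurable.\<close>
    have enough: "enough \<in> events"
      unfolding enough_def
    proof (intro sets.sets_Collect_finite_All assms(2))
      fix A assume "A \<in> \<A>"
      from borel_measurable_le[OF borel_measurable_const card_meas[OF this], of "real (k n)"]
      show "{S \<in> space (?P n). k n \<le> card {i\<in>{..<n}. S i \<in> A}} \<in> events"
        by (simp only: of_nat_le_iff)
    qed
    have "space (?P n) - (\<Union>A\<in>\<A>. few A) \<subseteq> enough"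
    proof
      fix S assume S: "S \<in> space (?P n) - (\<Union>A\<in>\<A>. few A)"
      have "k n \<le> card {i\<in>{..<n}. S i \<in> A}" if A: "A \<in> \<A>" for A
      proof -
        have "real n * measure D A / 2 < real (card {i\<in>{..<n}. S i \<in> A})"
          using S A unfolding few_def by (blast intro: leI)
        moreover have "real (k n) \<le> real n * measure D A / 2"
          using elim A by blast
        ultimately have "real (k n) \<le> real (card {i\<in>{..<n}. S i \<in> A})" by linarith
        then show ?thesis by (simp only: of_nat_le_iff)
      qed
      with S show "S \<in> enough" unfolding enough_def by blast
    qed
    have "prob (few A) \<le> exp (- (measure D A)\<^sup>2 / 2 * real n)" if "A \<in> \<A>" for A
      unfolding few_def using that elim assms(1,3) by (intro prob_PiM_few_hits_le) blast+
    then have "1 - (\<Sum>A\<in>\<A>. exp (- (measure D A)\<^sup>2 / 2 * real n)) \<le> 1 - (\<Sum>A\<in>\<A>. prob (few A))"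
      by (simp add: sum_mono)
    also have "\<dots> \<le> 1 - prob (\<Union>A\<in>\<A>. few A)"
      using finite_measure_subadditive_finite[OF assms(2), of few] few by fastforce
    also have "\<dots> = prob (space (?P n) - (\<Union>A\<in>\<A>. few A))"
      by (rule prob_compl[symmetric]) (use few assms(2) in blast)
    also have "\<dots> \<le> prob enough"
      using \<open>_ \<subseteq> enough\<close> enough by (rule finite_measure_mono)
    finally show ?case unfolding enough_def .
  qed
  have "(\<lambda>n. exp (- (measure D A)\<^sup>2 / 2 * real n)) \<longlonglongrightarrow> 0" if "A \<in> \<A>" for A
  proof -
    have "(measure D A)\<^sup>2 / 2 > 0" using assms(4)[OF that] by simp
    then have "filterlim (\<lambda>n. (measure D A)\<^sup>2 / 2 * real n) at_top sequentially"
      by (rule filterlim_tendsto_pos_mult_at_top[OF tendsto_const _ filterlim_real_sequentially])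
    then have "(\<lambda>n. exp (- ((measure D A)\<^sup>2 / 2 * real n))) \<longlonglongrightarrow> 0"
      by (intro filterlim_compose[OF exp_at_bot]) (simp add: filterlim_uminus_at_bot)
    then show ?thesis by simp
  qed
  then have "(\<lambda>n. 1 - (\<Sum>A\<in>\<A>. exp (- (measure D A)\<^sup>2 / 2 * real n))) \<longlonglongrightarrow> 1 - (\<Sum>A\<in>\<A>. 0)"
    by (intro tendsto_intros)
  then show "(\<lambda>n. 1 - (\<Sum>A\<in>\<A>. exp (- (measure D A)\<^sup>2 / 2 * real n))) \<longlonglongrightarrow> 1"
    by simp
  show "\<forall>\<^sub>F n in sequentially.
      measure (?P n) {S \<in> space (?P n). \<forall>A\<in>\<A>. k n \<le> card {i\<in>{..<n}. S i \<in> A}} \<le> 1"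
    by (intro always_eventually allI prob_space.prob_le_1 P)
qed simp

section \<open>Nearest neighbours of a single query point\<close>

text \<open>If a chosen \<open>i\<close> were farther than \<open>\<rho>\<close>, all points within
  \<open>\<rho>\<close> would be chosen too, so at least \<open>k n\<close> indices would fit into
  the \<open>k n - 1\<close> chosen ones other than \<open>i\<close>.\<close>

lemma nearest_neighbour_dist_le:
  assumes "nearest_neighbour_rule k nb" "n \<ge> 1" "i \<in> nb n xs x"
    and many: "k n \<le> card {j\<in>{..<n}. dist x (xs j) \<le> \<rho>}"
  shows "dist x (xs i) \<le> \<rho>"
proof (rule ccontr)
  assume far: "\<not> dist x (xs i) \<le> \<rho>"
  have nb: "nb n xs x \<subseteq> {..<n}" "card (nb n xs x) = k n"
    "\<And>j. j \<in> {..<n} - nb n xs x \<Longrightarrow> dist x (xs i) \<le> dist x (xs j)"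
    using assms unfolding nearest_neighbour_rule_def by blast+
  have fin: "finite (nb n xs x)" using nb(1) finite_subset by blast
  have "{j\<in>{..<n}. dist x (xs j) \<le> \<rho>} \<subseteq> nb n xs x - {i}"
    using nb(3) far by fastforce
  then have "k n \<le> card (nb n xs x - {i})"
    using many fin by (meson card_mono finite_Diff le_trans)
  also have "\<dots> < k n"
    using assms(3) fin nb(2) by (metis card_Diff1_less)
  finally show False by simp
qed

text \<open>A unanimous vote is an average of \<open>k n\<close> copies of \<open>y\<close>, so it
  equals \<open>y\<close> and has its sign; \<open>k n \<ge> 1\<close> keeps the weights from being
  a division by zero.\<close>

lemma knn_classifier_eq:
  assumes "nearest_neighbour_rule k nb" "n \<ge> 1" "k n \<ge> 1" "y \<in> labels"
    and lab: "\<And>i. i \<in> nb n (\<lambda>j. fst (S j)) x \<Longrightarrow> snd (S i) = y"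
  shows "knn_classifier k nb n S x = y"
proof -
  let ?N = "nb n (\<lambda>j. fst (S j)) x"
  have nb: "?N \<subseteq> {..<n}" "card ?N = k n"
    using assms unfolding nearest_neighbour_rule_def by blast+
  have "(\<Sum>i<n. knn_weight k nb n S i x * real_of_int (snd (S i)))
      = (\<Sum>i\<in>?N. knn_weight k nb n S i x * real_of_int (snd (S i)))"
    by (rule sum.mono_neutral_right) (use nb in \<open>auto simp: knn_weight_def\<close>)
  also have "\<dots> = (\<Sum>i\<in>?N. 1 / real (k n) * real_of_int y)"
    by (rule sum.cong) (auto simp: knn_weight_def lab)
  also have "\<dots> = real_of_int y"
    using nb assms(3) by simp
  finally show ?thesis
    using assms(4) by (auto simp: knn_classifier_def labels_def)
qed

section \<open>Consistency from a finite cover and separation\<close>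

theorem corollary14:
  fixes r :: real
    and D :: "('a::metric_space \<times> int) measure"
    and k :: "nat \<Rightarrow> nat"
    and nb :: "nat \<Rightarrow> (nat \<Rightarrow> 'a) \<Rightarrow> 'a \<Rightarrow> nat set"
  assumes "totally_bounded (UNIV :: 'a set)"
    and "r > 0"
    and "labelled_distribution D"
    and "r_separated r D"
    and "\<And>n. n \<ge> 1 \<Longrightarrow> 1 \<le> k n \<and> k n \<le> n"
    and "(\<lambda>n. real (k n) / real n) \<longlonglongrightarrow> 0"
    and "nearest_neighbour_rule k nb"
  shows "r_consistent r (knn_classifier k nb) D"
proof -
  interpret D: prob_space D
    using assms(3) by (simp add: labelled_distribution_def)
  have setsD: "sets D = sets (borel \<Otimes>\<^sub>M count_space labels)"
    using assms(3) by (simp add: labelled_distribution_def)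
  have spaceD: "space D = UNIV \<times> labels"
    using sets_eq_imp_space_eq[OF setsD] by (simp add: space_pair_measure)
  obtain Tpos Tneg where T: "AE (x, y) in D. x \<in> (if y = 1 then Tpos else Tneg)"
    and far: "\<And>x1 x2. x1 \<in> Tpos \<Longrightarrow> x2 \<in> Tneg \<Longrightarrow> dist x1 x2 > 2 * r"
    using assms(4) unfolding r_separated_def by blast
  define T where "T = {(x, y) \<in> space D. x \<in> (if y = 1 then Tpos else Tneg)}"
  have "AE z in D. z \<in> T"
    using T AE_space by eventually_elim (auto simp: T_def)
  \<comment> \<open>Separation is applied in both orders, since either point may be the positive
    one.\<close>
  have same_label: "y = y'" if "(x, y) \<in> T" "(x', y') \<in> T" "dist x x' \<le> 2 * r" for x y x' y'
    using that far[of x x'] far[of x' x]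
    by (auto simp: T_def spaceD labels_def dist_commute split: if_splits)
  show ?thesis
    unfolding r_consistent_def
  proof (intro allI impI)
    fix \<epsilon> \<delta> \<gamma> :: real
    assume "0 < \<epsilon> \<and> \<epsilon> < 1 \<and> 0 < \<delta> \<and> \<delta> < 1 \<and> 0 < \<gamma> \<and> \<gamma> < r"
    then have \<epsilon>: "0 < \<epsilon>" and \<delta>: "0 < \<delta>" "\<delta> < 1" and \<gamma>: "0 < \<gamma>" "\<gamma> < r" by auto
    let ?P = "\<lambda>n. \<Pi>\<^sub>M i\<in>{..<n}. D"
    \<comment> \<open>Radius \<open>\<gamma> / 2\<close> puts two points of one ball less than
      \<open>\<gamma>\<close> apart, which is the slack between \<open>r - \<gamma>\<close> and
      \<open>r\<close>.\<close>
    obtain C where C: "finite C" "UNIV \<subseteq> (\<Union>c\<in>C. {y::'a. dist c y < \<gamma> / 2})"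
      using assms(1) \<gamma> unfolding totally_bounded_metric by (meson half_gt_zero)
    \<comment> \<open>The factor \<open>labels\<close> turns balls into events of \<open>D\<close>,
      so their measure is the marginal mass of the ball.\<close>
    define \<B> where "\<B> = (\<lambda>c. ball c (\<gamma> / 2) \<times> labels) ` C"
    have \<B>: "finite \<B>" "\<B> \<subseteq> sets D"
      using C(1) by (auto simp: \<B>_def setsD)
    define \<A> where "\<A> = {B \<in> \<B>. measure D B > 0}"
    have "AE z in D. \<forall>B\<in>\<B> - \<A>. z \<notin> B"
    proof (intro AE_ball_countable[THEN iffD2] ballI)
      show "countable (\<B> - \<A>)" using \<B>(1) by (simp add: countable_finite)
      fix B assume "B \<in> \<B> - \<A>"
      then have "B \<in> null_sets D"
        using \<B>(2) by (auto simp: \<A>_def D.emeasure_eq_measure zero_less_measure_iff null_sets_def)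
      then show "AE z in D. z \<notin> B" by (rule AE_not_in)
    qed
    \<comment> \<open>The discarded balls are finitely many null sets.\<close>
    then have covered: "AE z in D. z \<in> \<Union>\<A>"
      using AE_space
    proof eventually_elim
      case (elim z)
      obtain c where "c \<in> C" "dist c (fst z) < \<gamma> / 2"
        using C(2) by blast
      then have "c \<in> C" "z \<in> ball c (\<gamma> / 2) \<times> labels"
        using elim(2) by (auto simp: spaceD)
      then have "\<exists>B\<in>\<B>. z \<in> B" by (auto simp: \<B>_def)
      with elim show ?case by blast
    qed
    \<comment> \<open>The deterministic core: every fixed sample with these properties gives
      astuteness 1; randomness remains only in the test point.\<close>
    have astute: "astuteness (r - \<gamma>) (knn_classifier k nb n S) D = 1"
      if n: "n \<ge> 1" and S: "\<And>i. i < n \<Longrightarrow> S i \<in> T"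
        and hits: "\<And>A. A \<in> \<A> \<Longrightarrow> k n \<le> card {i\<in>{..<n}. S i \<in> A}" for n S
      unfolding astuteness_def
    proof (rule D.inner_prob_eq_1)
      show "AE z in D. z \<in> {(x, y) \<in> space D. \<forall>x'\<in>cball x (r - \<gamma>). knn_classifier k nb n S x' = y}"
        using \<open>AE z in D. z \<in> T\<close> covered
      proof eventually_elim
        case (elim z)
        obtain x y where z: "z = (x, y)" by fastforce
        from elim obtain A where A: "A \<in> \<A>" "z \<in> A" by blast
        then obtain c where c: "A = ball c (\<gamma> / 2) \<times> labels"
          by (auto simp: \<A>_def \<B>_def)
        have "knn_classifier k nb n S x' = y" if x': "dist x x' \<le> r - \<gamma>" for x'
        proof (rule knn_classifier_eq)
          \<comment> \<open>The path through \<open>x\<close> has length below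
            \<open>(r - \<gamma>) + \<gamma>\<close>.\<close>
          have near: "dist x' (fst (S i)) \<le> r" if "S i \<in> A" for i
          proof -
            have "dist c x < \<gamma> / 2" "dist c (fst (S i)) < \<gamma> / 2"
              using A(2) that by (auto simp: c z)
            then show ?thesis
              using x' dist_triangle[of x' "fst (S i)" x] dist_triangle3[of x "fst (S i)" c]
              by (simp add: dist_commute)
          qed
          have "k n \<le> card {i\<in>{..<n}. S i \<in> A}"
            using A(1) by (rule hits)
          also have "\<dots> \<le> card {i\<in>{..<n}. dist x' (fst (S i)) \<le> r}"
            by (rule card_mono) (auto intro: near)
          finally have many: "k n \<le> card {i\<in>{..<n}. dist x' (fst (S i)) \<le> r}" .
          fix i assume i: "i \<in> nb n (\<lambda>j. fst (S j)) x'"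
          then have "i < n"
            using assms(7) n unfolding nearest_neighbour_rule_def by blast
          have "dist x' (fst (S i)) \<le> r"
            using nearest_neighbour_dist_le[OF assms(7) n i many] .
          \<comment> \<open>Going back from \<open>x'\<close> to \<open>x\<close> costs at most
            \<open>r - \<gamma>\<close> more, within the reach of \<open>same_label\<close>.\<close>
          then have "dist x (fst (S i)) \<le> 2 * r"
            using x' \<gamma> dist_triangle[of x "fst (S i)" x'] by simp
          then show "snd (S i) = y"
            using same_label[of x y "fst (S i)" "snd (S i)"] S[OF \<open>i < n\<close>] elim(1) z by simp
        qed (use assms(5,7) n elim(1) in \<open>auto simp: z T_def spaceD\<close>)
        then show ?case
          using elim(1) by (auto simp: z T_def)
      qed
    qed
    define hit where
      "hit n = {S \<in> space (?P n). \<forall>A\<in>\<A>. k n \<le> card {i\<in>{..<n}. S i \<in> A}}" for n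
    have "(\<lambda>n. measure (?P n) (hit n)) \<longlonglongrightarrow> 1"
      unfolding hit_def
      by (rule prob_PiM_hits_tendsto_1)
         (use \<B> assms(6) D.prob_space_axioms in \<open>auto simp: \<A>_def\<close>)
    then have "\<forall>\<^sub>F n in sequentially. measure (?P n) (hit n) > 1 - \<delta>"
      by (rule order_tendstoD) (use \<delta> in simp)
    then have "\<forall>\<^sub>F n in sequentially. inner_prob (?P n)
        {S \<in> space (?P n). astuteness (r - \<gamma>) (knn_classifier k nb n S) D
           \<ge> optimal_astuteness r D - \<epsilon>} \<ge> 1 - \<delta>"
      using eventually_ge_at_top[of 1]
    proof eventually_elim
      case (elim n)
      interpret P: prob_space "?P n" by (rule prob_space_PiM) (rule D.prob_space_axioms)
      \<comment> \<open>A nonmeasurable set would have \<open>measure\<close> 0, but here it exceeds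
        \<open>1 - \<delta> > 0\<close>.\<close>
      have "hit n \<in> P.events"
        using elim(1) \<delta> measure_notin_sets[of "hit n" "?P n"] by fastforce
      \<comment> \<open>Separation holds only almost surely, so samples leaving \<open>T\<close> in
        one of the finitely many coordinates are dropped as a null set.\<close>
      have "AE S in ?P n. \<forall>i\<in>{..<n}. S i \<in> T"
        by (intro AE_finite_allI AE_PiM_component D.prob_space_axioms \<open>AE z in D. z \<in> T\<close>) auto
      then have "AE S in ?P n. S \<in> hit n \<longrightarrow> S \<in> {S \<in> space (?P n).
          astuteness (r - \<gamma>) (knn_classifier k nb n S) D \<ge> optimal_astuteness r D - \<epsilon>}"
      proof eventually_elim
        case S: (elim S)
        have "astuteness (r - \<gamma>) (knn_classifier k nb n S) D = 1" if "S \<in> hit n"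
          using that S elim(2) by (intro astute) (auto simp: hit_def)
        then show ?case
          using optimal_astuteness_le_1[OF D.prob_space_axioms, of r] \<epsilon> by (auto simp: hit_def)
      qed
      from P.prob_le_inner_prob_AE[OF \<open>hit n \<in> P.events\<close> this] elim(1) show ?case by simp
    qed
    then show "\<exists>N. \<forall>n\<ge>N. inner_prob (?P n)
        {S \<in> space (?P n). astuteness (r - \<gamma>) (knn_classifier k nb n S) D
           \<ge> optimal_astuteness r D - \<epsilon>} \<ge> 1 - \<delta>"
      by (simp add: eventually_sequentially)
  qed
qed

end
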